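(* Let $a\geq 0$ and $b\geq 1$. There is an integer $n_0=n_0(a,b)\geq 2$, depending only on $a$ and $b$, such that the following holds for every $\delta\ge 1$. For every $\delta$-hyperbolic geodesic space $(X,d)$ and every $n\geq n_0$, if there is a map $\varphi\colon C_n\to X$ such that for all $x,y\in C_n$ $$a\,d_{C_n}(x,y) \leq d(\varphi(x),\varphi(y)) \leq b\,d_{C_n}(x,y),$$ then $$a< 6\delta\cdot \frac{\log n}{n}.$$
   Context: A geodesic metric space $(X,d)$ is $\delta$-hyperbolic if each side of every geodesic triangle in $X$ is contained in the $\delta$-neighbourhood of the union of the other two sides. $C_n$ denotes the cycle of length $n\ge2$, i.e. the vertex set $\mathbb{Z}/n\mathbb{Z}$ of the Cayley graph of $\mathbb{Z}/n\mathbb{Z}$ with respect to the generator $1$, viewed as a discrete metric space with the graph distance $d_{C_n}$. $\log$ is the natural logarithm. *)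

theory Defs
  imports "HOL-Analysis.Analysis"
begin

context Metric_space
begin

definition geodesic_segment :: "'a \<Rightarrow> 'a \<Rightarrow> 'a set \<Rightarrow> bool" where
  "geodesic_segment x y S \<longleftrightarrow>
     (\<exists>\<gamma>. \<gamma> \<in> {0..d x y} \<rightarrow> M \<and> \<gamma> 0 = x \<and> \<gamma> (d x y) = y \<and>
          (\<forall>s\<in>{0..d x y}. \<forall>t\<in>{0..d x y}. d (\<gamma> s) (\<gamma> t) = \<bar>s - t\<bar>) \<and>
          S = \<gamma> ` {0..d x y})"

definition geodesic_space :: bool where
  "geodesic_space \<longleftrightarrow> (\<forall>x\<in>M. \<forall>y\<in>M. \<exists>S. geodesic_segment x y S)"

(* Closed neighbourhood. Sides of triangles are compact, so this is the same as
   infdist at most r; it makes hyperbolicity (weakly) more permissive than open neighbourhoods. *)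
definition nbhd :: "real \<Rightarrow> 'a set \<Rightarrow> 'a set" where
  "nbhd r A = (\<Union>q\<in>A. mcball q r)"

definition hyperbolic :: "real \<Rightarrow> bool" where
  "hyperbolic \<delta> \<longleftrightarrow>
     (\<forall>x\<in>M. \<forall>y\<in>M. \<forall>z\<in>M. \<forall>S T U.
        geodesic_segment x y S \<and> geodesic_segment y z T \<and> geodesic_segment z x U \<longrightarrow>
        S \<subseteq> nbhd \<delta> (T \<union> U) \<and> T \<subseteq> nbhd \<delta> (U \<union> S) \<and> U \<subseteq> nbhd \<delta> (S \<union> T))"

end

(* Vertices of C_n are the residues {0..<n}; the edge relation is symmetrised. *)
definition cycle_edges :: "nat \<Rightarrow> (nat \<times> nat) set" where
  "cycle_edges n = {(i, j). i < n \<and> j < n \<and> (j = (i + 1) mod n \<or> i = (j + 1) mod n)}"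

(* Length of a shortest walk; only meaningful for vertices, as C_n is connected. *)
definition cycle_dist :: "nat \<Rightarrow> nat \<Rightarrow> nat \<Rightarrow> nat" where
  "cycle_dist n i j = (LEAST k. (i, j) \<in> cycle_edges n ^^ k)"

(* N works as threshold for all spaces whose points are taken from the type 'a. *)
definition admissible_threshold :: "'a itself \<Rightarrow> real \<Rightarrow> real \<Rightarrow> nat \<Rightarrow> bool" where
  "admissible_threshold TYPE('a) a b N \<longleftrightarrow>
     (\<forall>\<delta>\<ge>1. \<forall>(M :: 'a set) d.
        Metric_space M d \<and> Metric_space.geodesic_space M d \<and> Metric_space.hyperbolic M d \<delta> \<longrightarrow>
        (\<forall>n\<ge>N.
           (\<exists>\<phi> \<in> {0..<n} \<rightarrow> M. \<forall>x\<in>{0..<n}. \<forall>y\<in>{0..<n}.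
              a * real (cycle_dist n x y) \<le> d (\<phi> x) (\<phi> y) \<and>
              d (\<phi> x) (\<phi> y) \<le> b * real (cycle_dist n x y)) \<longrightarrow>
           a < 6 * \<delta> * (ln (real n) / real n)))"

(* HOL cannot quantify over types inside a formula, so an existentially quantified threshold in a
   statement about spaces in 'a would be allowed to depend on 'a. Naming it by a constant makes it a
   function of a and b alone. The choice of the type real here is no restriction on the spaces: finitely
   many points of a geodesic space lie in a geodesic subspace of cardinality at most the continuum,
   which inherits hyperbolicity, so a threshold for carriers in real is one for all carriers. *)
definition n\<^sub>0 :: "real \<Rightarrow> real \<Rightarrow> nat" where
  "n\<^sub>0 a b = (LEAST N. N \<ge> 2 \<and> admissible_threshold TYPE(real) a b N)"

end

theory Submission
  imports Defs
begin

text \<open>Suppose that \<open>a > 0\<close> and \<open>a \<ge> 6 \<delta> ln n / n\<close>. As \<open>a\<close> is fixed, this says that \<open>\<delta>\<close> is at most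
  \<open>a n / (6 ln n)\<close>, hence negligible compared with \<open>n\<close>. Cut the cycle into a number of pieces that
  depends only on \<open>a\<close> and \<open>b\<close>. The midpoint of a geodesic between the images of two antipodal
  vertices is then within \<open>\<epsilon> n\<close> of vertices \<open>i\<close> and \<open>j\<close> in the two arcs, because a geodesic polygon
  with boundedly many sides is \<open>O(\<delta>)\<close>-thin. By the upper Lipschitz bound \<open>i\<close> and \<open>j\<close> are at a distance
  proportional to \<open>n\<close> from the antipodal vertices, hence from each other, and the lower bound is
  violated.

  Since \<open>n\<^sub>0\<close> is the least threshold for spaces of real numbers, it may be smaller than the one
  obtained in this way. So a threshold for carriers in the reals has to be carried over to all
  carriers: a finite set of points lies in a geodesic subspace of at most continuum cardinality,
  obtained by adding chosen geodesics countably often.\<close>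

unbundle cardinal_syntax

subsection \<open>The distance on a cycle\<close>

text \<open>An edge changes \<open>\<bar>i - j\<bar>\<close> by one or wraps between
  \<open>n - 1\<close> and \<open>0\<close>; either way the minimum of the two arc lengths grows by
  at most one.\<close>

lemma cycle_edges_relpow_imp_dist:
  assumes "(i, j) \<in> cycle_edges n ^^ k" "i < n"
  shows "j < n \<and> min \<bar>int i - int j\<bar> (int n - \<bar>int i - int j\<bar>) \<le> int k"
  using assms
proof (induction k arbitrary: j)
  case 0
  then show ?case by auto
next
  case (Suc k)
  then obtain l where l: "(i, l) \<in> cycle_edges n ^^ k" "(l, j) \<in> cycle_edges n"
    by auto
  with Suc have "l < n" and IH: "min \<bar>int i - int l\<bar> (int n - \<bar>int i - int l\<bar>) \<le> int k"
    by auto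
  moreover have "j < n" and "j = (l + 1) mod n \<or> l = (j + 1) mod n"
    using l by (auto simp: cycle_edges_def)
  \<comment> \<open>Replacing \<open>mod\<close> by a case distinction leaves linear
    arithmetic.\<close>
  moreover have "(r + 1) mod n = (if r + 1 = n then 0 else r + 1)" if "r < n" for r
    using that by auto
  ultimately have "j = l + 1 \<or> l = j + 1 \<or> (l + 1 = n \<and> j = 0) \<or> (j + 1 = n \<and> l = 0)"
    by (metis)
  with IH \<open>l < n\<close> \<open>j < n\<close> \<open>i < n\<close> show ?case
    by (auto simp: min_def abs_if split: if_splits)
qed

text \<open>These walks ensure that the \<open>LEAST\<close> in \<open>cycle_dist\<close> is
  attained, whichever vertex comes first.\<close>

lemma cycle_edges_relpow_add:
  assumes "i + k < n"
  shows "(i, i + k) \<in> cycle_edges n ^^ k \<and> (i + k, i) \<in> cycle_edges n ^^ k"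
  using assms
proof (induction k)
  case 0
  then show ?case by simp
next
  case (Suc k)
  then have IH: "(i, i + k) \<in> cycle_edges n ^^ k" "(i + k, i) \<in> cycle_edges n ^^ k"
    by auto
  have e: "(i + k, i + Suc k) \<in> cycle_edges n" "(i + Suc k, i + k) \<in> cycle_edges n"
    using Suc.prems by (auto simp: cycle_edges_def)
  show ?case
    using relpow_Suc_I[OF IH(1) e(1)] relpow_Suc_I2[OF e(2) IH(2)] by blast
qed

lemma cycle_dist_lower:
  assumes "i < n" "j < n"
  shows "min \<bar>int i - int j\<bar> (int n - \<bar>int i - int j\<bar>) \<le> int (cycle_dist n i j)"
proof -
  have "\<exists>k. (i, j) \<in> cycle_edges n ^^ k"
  proof (cases "i \<le> j")
    case True
    then show ?thesis using cycle_edges_relpow_add[of i "j - i" n] assms by auto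
  next
    case False
    then show ?thesis using cycle_edges_relpow_add[of j "i - j" n] assms by auto
  qed
  then have "(i, j) \<in> cycle_edges n ^^ cycle_dist n i j"
    unfolding cycle_dist_def by (rule LeastI_ex)
  with cycle_edges_relpow_imp_dist assms show ?thesis by blast
qed

lemma cycle_dist_adjacent_le:
  assumes "(i, j) \<in> cycle_edges n"
  shows "cycle_dist n i j \<le> 1"
  unfolding cycle_dist_def by (rule Least_le) (use assms in auto)

subsection \<open>Geodesic polygons\<close>

context Metric_space
begin

lemma geodesic_segment_sym:
  assumes "geodesic_segment x y S"
  shows "geodesic_segment y x S"
proof -
  obtain \<gamma> where \<gamma>: "\<gamma> \<in> {0..d x y} \<rightarrow> M" "\<gamma> 0 = x" "\<gamma> (d x y) = y"
    "\<forall>s\<in>{0..d x y}. \<forall>t\<in>{0..d x y}. d (\<gamma> s) (\<gamma> t) = \<bar>s - t\<bar>" "S = \<gamma> ` {0..d x y}"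
    using assms unfolding geodesic_segment_def by blast
  have "(\<lambda>t. d x y - t) ` {0..d x y} = {0..d x y}"
    by simp
  then have "(\<lambda>t. \<gamma> (d x y - t)) ` {0..d x y} = S"
    using \<gamma>(5) by (metis image_image)
  with \<gamma> show ?thesis
    unfolding geodesic_segment_def commute[of y x]
    by (intro exI[of _ "\<lambda>t. \<gamma> (d x y - t)"]) (auto simp: Pi_iff)
qed

lemma geodesic_segment_subset: "geodesic_segment x y S \<Longrightarrow> S \<subseteq> M"
  unfolding geodesic_segment_def by auto

lemma geodesic_segment_dist_left_le:
  assumes "geodesic_segment x y S" "z \<in> S"
  shows "d z x \<le> d x y"
proof -
  obtain \<gamma> where \<gamma>: "\<gamma> 0 = x"
    "\<forall>s\<in>{0..d x y}. \<forall>t\<in>{0..d x y}. d (\<gamma> s) (\<gamma> t) = \<bar>s - t\<bar>" "S = \<gamma> ` {0..d x y}"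
    using assms unfolding geodesic_segment_def by blast
  from assms(2) \<gamma>(3) obtain t where t: "t \<in> {0..d x y}" "z = \<gamma> t" by blast
  then show ?thesis using \<gamma>(1) \<gamma>(2)[rule_format, of t 0] by auto
qed

lemma geodesic_segment_midpoint:
  assumes "geodesic_segment x y S"
  obtains z where "z \<in> S" "d z x = d x y / 2" "d z y = d x y / 2"
proof -
  obtain \<gamma> where \<gamma>: "\<gamma> 0 = x" "\<gamma> (d x y) = y"
    "\<forall>s\<in>{0..d x y}. \<forall>t\<in>{0..d x y}. d (\<gamma> s) (\<gamma> t) = \<bar>s - t\<bar>" "S = \<gamma> ` {0..d x y}"
    using assms unfolding geodesic_segment_def by blast
  have mem: "0 \<in> {0..d x y}" "d x y / 2 \<in> {0..d x y}" "d x y \<in> {0..d x y}" by simp_all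
  show ?thesis
  proof (rule that[of "\<gamma> (d x y / 2)"])
    show "\<gamma> (d x y / 2) \<in> S" using \<gamma>(4) mem(2) by blast
    show "d (\<gamma> (d x y / 2)) x = d x y / 2"
      using \<gamma>(3)[rule_format, OF mem(2,1)] \<gamma>(1) by simp
    show "d (\<gamma> (d x y / 2)) y = d x y / 2"
      using \<gamma>(3)[rule_format, OF mem(2,3)] \<gamma>(2) by simp
  qed
qed

lemma hyperbolic_triangle:
  assumes "hyperbolic \<delta>" "x \<in> M" "y \<in> M" "z \<in> M"
    and "geodesic_segment x y T" "geodesic_segment y z U" "geodesic_segment x z S" "p \<in> S"
  obtains q where "q \<in> T \<union> U" "d p q \<le> \<delta>"
proof -
  have "geodesic_segment z x S" using assms by (simp add: geodesic_segment_sym)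
  with assms have "S \<subseteq> nbhd \<delta> (T \<union> U)" unfolding hyperbolic_def by blast
  with assms(8) that show ?thesis unfolding nbhd_def by (force simp: commute)
qed

text \<open>The bound is linear in the number of sides rather than logarithmic; this suffices since the
  number of sides will be chosen independently of the length of the cycle.\<close>

lemma hyperbolic_polygon:
  assumes "geodesic_space" "hyperbolic \<delta>" "\<And>i. f i \<in> M"
    and "geodesic_segment (f 0) (f (Suc N)) S" "x \<in> S"
  shows "\<exists>s\<le>N. \<exists>T. geodesic_segment (f s) (f (Suc s)) T \<and> (\<exists>y\<in>T. d x y \<le> N * \<delta>)"
  using assms(4,5)
proof (induction N arbitrary: S x)
  case 0
  then have "d x x = 0" using geodesic_segment_subset by force
  with 0 show ?case by force
next
  case (Suc N)
  \<comment> \<open>\<open>T\<close> is the diagonal cutting off the last side. Each such cut costs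
    one \<delta>.\<close>
  obtain T where T: "geodesic_segment (f 0) (f (Suc N)) T"
    using assms(1,3) unfolding geodesic_space_def by blast
  obtain U where U: "geodesic_segment (f (Suc N)) (f (Suc (Suc N))) U"
    using assms(1,3) unfolding geodesic_space_def by blast
  obtain q where q: "q \<in> T \<union> U" "d x q \<le> \<delta>"
    using hyperbolic_triangle[OF assms(2,3,3,3) T U Suc.prems] by blast
  have mem: "x \<in> M" "q \<in> M"
    using q Suc.prems T U geodesic_segment_subset by blast+
  \<comment> \<open>The sign of \<delta> is read off from a distance bounded by it.\<close>
  have \<delta>: "0 \<le> \<delta>" using q(2) nonneg order_trans by blast
  show ?case
  proof (cases "q \<in> T")
    case True
    from Suc.IH[OF T True] obtain s T' y where s: "s \<le> N" "geodesic_segment (f s) (f (Suc s)) T'"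
      "y \<in> T'" "d q y \<le> N * \<delta>" by blast
    have "d x y \<le> d x q + d q y"
      using mem s(2,3) geodesic_segment_subset triangle by blast
    also have "\<dots> \<le> Suc N * \<delta>" using q(2) s(4) by (simp add: algebra_simps)
    finally show ?thesis using s by (meson le_SucI)
  next
    case False
    have "d x q \<le> Suc N * \<delta>"
      using q(2) \<delta> by (simp add: algebra_simps add_increasing2)
    with False q(1) U show ?thesis by blast
  qed
qed

text \<open>Vertices taken every \<open>h\<close> steps turn the arc into a polygon with sides of
  length at most \<open>b * h\<close>. Thinness puts \<open>x\<close> within
  \<open>N * \<delta>\<close> of a side, and each point of a side is within \<open>b * h\<close> of
  its first vertex.\<close>

lemma hyperbolic_arc:
  assumes "geodesic_space" "hyperbolic \<delta>" "\<And>i. \<psi> i \<in> M"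
    and lip: "\<And>i j. i \<le> j \<Longrightarrow> d (\<psi> i) (\<psi> j) \<le> b * real (j - i)" and "0 \<le> b"
    and "p \<le> q" "q \<le> p + Suc N * h"
    and S: "geodesic_segment (\<psi> p) (\<psi> q) S" and "x \<in> S"
  obtains i where "p \<le> i" "i \<le> q" "d x (\<psi> i) \<le> N * \<delta> + b * h"
proof -
  \<comment> \<open>Truncation at \<open>q\<close> keeps the number of sides at
    \<open>Suc N\<close>; the last ones may be degenerate.\<close>
  define e where "e s = min (p + s * h) q" for s
  have e: "e 0 = p" "e (Suc N) = q" using assms(6,7) by (auto simp: e_def)
  have "geodesic_segment (\<psi> (e 0)) (\<psi> (e (Suc N))) S" using S e by simp
  from hyperbolic_polygon[OF assms(1,2), of "\<lambda>s. \<psi> (e s)", OF assms(3) this \<open>x \<in> S\<close>]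
  obtain s T y where s: "geodesic_segment (\<psi> (e s)) (\<psi> (e (Suc s))) T" "y \<in> T" "d x y \<le> N * \<delta>"
    by blast
  have "e s \<le> e (Suc s)" "e (Suc s) - e s \<le> h" by (auto simp: e_def)
  then have "d (\<psi> (e s)) (\<psi> (e (Suc s))) \<le> b * h"
    using lip[of "e s" "e (Suc s)"] \<open>0 \<le> b\<close>
    by (smt (verit) mult_left_mono of_nat_le_iff)
  then have "d y (\<psi> (e s)) \<le> b * h"
    using geodesic_segment_dist_left_le[OF s(1,2)] by linarith
  moreover have "d x (\<psi> (e s)) \<le> d x y + d y (\<psi> (e s))"
    using triangle geodesic_segment_subset S \<open>x \<in> S\<close> s assms(3) by blast
  moreover have "p \<le> e s" "e s \<le> q" using \<open>p \<le> q\<close> by (auto simp: e_def)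
  ultimately show ?thesis using that[of "e s"] s(3) by linarith
qed

text \<open>The midpoint of a geodesic joining two antipodal vertices is close to both arcs between them,
  but the upper Lipschitz bound keeps it away from the two vertices themselves.\<close>

lemma hyperbolic_cycle_bound:
  assumes "geodesic_space" "hyperbolic \<delta>" "\<And>i. \<psi> i \<in> M"
    and lip: "\<And>i j. i \<le> j \<Longrightarrow> d (\<psi> i) (\<psi> j) \<le> b * real (j - i)"
    and low: "\<And>i j. i \<le> j \<Longrightarrow> j \<le> n \<Longrightarrow> a * real (min (j - i) (n - (j - i))) \<le> d (\<psi> i) (\<psi> j)"
    and closed: "\<psi> n = \<psi> 0" and "0 < a" "0 < b"
  shows "a\<^sup>2 * (real n - 1) / 4 \<le> (a + b) * (N * \<delta> + b * (n / Suc N + 1))"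
proof -
  define m where "m = n div 2"
  \<comment> \<open>The \<open>+ 1\<close> makes \<open>Suc N\<close> steps of length
    \<open>h\<close> cover the whole cycle, hence each of the two arcs.\<close>
  define h where "h = n div Suc N + 1"
  define R where "R = N * \<delta> + b * h"
  have m: "m \<le> n" "real n - 1 \<le> 2 * real m" "m \<le> n - m" unfolding m_def by linarith+
  have h: "n \<le> Suc N * h"
    unfolding h_def using mult_div_mod_eq[of "Suc N" n] mod_less_divisor[of "Suc N" n]
    by (metis Suc_eq_plus1 div_less_iff_less_mult lessI less_imp_le_nat mult.commute zero_less_Suc)
  obtain S where S: "geodesic_segment (\<psi> 0) (\<psi> m) S"
    using assms(1,3) unfolding geodesic_space_def by blast
  \<comment> \<open>Read backwards, the same geodesic spans the other arc, so a single midpoint is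
    close to both.\<close>
  have S': "geodesic_segment (\<psi> m) (\<psi> n) S"
    using S closed geodesic_segment_sym by metis
  obtain x where x: "x \<in> S" "d x (\<psi> 0) = d (\<psi> 0) (\<psi> m) / 2" "d x (\<psi> m) = d (\<psi> 0) (\<psi> m) / 2"
    using geodesic_segment_midpoint[OF S] by blast
  have xM: "x \<in> M" using S x(1) geodesic_segment_subset by blast
  have b0: "0 \<le> b" using \<open>0 < b\<close> by simp
  obtain i where i: "0 \<le> i" "i \<le> m" "d x (\<psi> i) \<le> R"
    unfolding R_def
    by (rule hyperbolic_arc[OF assms(1-4) b0 _ _ S x(1), of N h]) (use h m(1) in auto)
  obtain j where j: "m \<le> j" "j \<le> n" "d x (\<psi> j) \<le> R"
    unfolding R_def
    by (rule hyperbolic_arc[OF assms(1-4) b0 _ _ S' x(1), of N h]) (use h m(1) in auto)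
  define D where "D = d (\<psi> 0) (\<psi> m)"
  have D: "a * m \<le> D"
    using low[of 0 m] m unfolding D_def by simp
  have far: "D / 2 - R \<le> d (\<psi> k) (\<psi> l)"
    if "d x (\<psi> k) \<le> R" "d x (\<psi> l) = D / 2" for k l
  proof -
    have "d x (\<psi> l) \<le> d x (\<psi> k) + d (\<psi> k) (\<psi> l)"
      using xM assms(3) triangle by blast
    with that show ?thesis by linarith
  qed
  have x': "d x (\<psi> 0) = D / 2" "d x (\<psi> m) = D / 2" "d x (\<psi> n) = D / 2"
    using x closed unfolding D_def by auto
  \<comment> \<open>The midpoint is at distance \<open>D / 2\<close> from both ends, so
    \<open>i\<close> and \<open>j\<close>, being near it, are far from \<open>0\<close>,
    \<open>m\<close> and \<open>n\<close>; \<open>lip\<close> turns this into index gaps.\<close>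
  have "D / 2 - R \<le> b * real i"
    using far[OF i(3) x'(1)] lip[of 0 i] commute[of "\<psi> 0"] by force
  moreover have "D / 2 - R \<le> b * real (m - i)"
    using far[OF i(3) x'(2)] lip[of i m] i by force
  moreover have "D / 2 - R \<le> b * real (j - m)"
    using far[OF j(3) x'(2)] lip[of m j] j commute[of "\<psi> m"] by force
  moreover have "D / 2 - R \<le> b * real (n - j)"
    using far[OF j(3) x'(3)] lip[of j n] j by force
  \<comment> \<open>One way from \<open>i\<close> to \<open>j\<close> passes \<open>m\<close> and
    has length \<open>(m - i) + (j - m)\<close>; the other passes \<open>n\<close>, identified with
    \<open>0\<close>, and has length \<open>i + (n - j)\<close>.\<close>
  ultimately have sep: "D - 2 * R \<le> b * real (j - i)" "D - 2 * R \<le> b * real (n - (j - i))"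
    using i j m(1) by (auto simp: of_nat_diff algebra_simps)
  then have "D - 2 * R \<le> b * real (min (j - i) (n - (j - i)))"
    by (cases "j - i \<le> n - (j - i)") (simp_all only: min_def if_True if_False)
  then have "a * (D - 2 * R) \<le> a * (b * real (min (j - i) (n - (j - i))))"
    using \<open>0 < a\<close> by simp
  also have "\<dots> = b * (a * real (min (j - i) (n - (j - i))))"
    by simp
  also have "\<dots> \<le> b * d (\<psi> i) (\<psi> j)"
    using low[of i j] i j b0 by (intro mult_left_mono) auto
  also have "\<dots> \<le> b * (2 * R)"
  proof -
    have "d (\<psi> i) (\<psi> j) \<le> d x (\<psi> i) + d x (\<psi> j)"
      using xM assms(3) triangle'' by blast
    with i(3) j(3) b0 show ?thesis by (intro mult_left_mono) auto
  qed
  finally have "a * D \<le> 2 * ((a + b) * R)" by (simp add: algebra_simps)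
  \<comment> \<open>The chain is \<open>a\<^sup>2 * (n - 1) \<le> 2 * a\<^sup>2 * m \<le> 2 * a * D
    \<le> 4 * (a + b) * R\<close>.\<close>
  moreover have "a\<^sup>2 * (real n - 1) \<le> a\<^sup>2 * (2 * m)"
    using m(2) by (intro mult_left_mono) auto
  moreover have "a * (a * m) \<le> a * D" using D \<open>0 < a\<close> by simp
  ultimately have "a\<^sup>2 * (real n - 1) / 4 \<le> (a + b) * R"
    by (simp add: power2_eq_square)
  also have "\<dots> \<le> (a + b) * (N * \<delta> + b * (n / Suc N + 1))"
  proof -
    have "real (n div Suc N) \<le> real n / real (Suc N)" by (rule of_nat_div_le_of_nat)
    then show ?thesis
      using \<open>0 < a\<close> \<open>0 < b\<close> unfolding R_def h_def
      by (intro mult_left_mono add_left_mono) auto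
  qed
  finally show ?thesis .
qed

subsection \<open>Geodesic closure and change of carrier\<close>

text \<open>A geodesic is the image of a real interval, and the continuum is stable under the unions
  formed here. Two points of the limit lie in a common stage, so the next stage contains their
  chosen geodesic.\<close>

lemma geodesic_closure_continuum:
  assumes "geodesic_space" "A \<subseteq> M" "|A| \<le>o |UNIV :: real set|"
  obtains B where "A \<subseteq> B" "B \<subseteq> M" "|B| \<le>o |UNIV :: real set|"
    and "\<And>x y. x \<in> B \<Longrightarrow> y \<in> B \<Longrightarrow> \<exists>S\<subseteq>B. geodesic_segment x y S"
proof -
  let ?c = "|UNIV :: real set|"
  have inf: "infinite (UNIV :: real set)" by (rule infinite_UNIV_char_0)
  \<comment> \<open>One geodesic is chosen per pair, since the union of all of them could exceed the
    continuum.\<close>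
  obtain G where G: "\<And>x y. x \<in> M \<Longrightarrow> y \<in> M \<Longrightarrow> geodesic_segment x y (G x y)"
    using assms(1) unfolding geodesic_space_def by metis
  have card_G: "|G x y| \<le>o ?c" if xy: "x \<in> M" "y \<in> M" for x y
  proof -
    obtain \<gamma> where "G x y = \<gamma> ` {0..d x y}"
      using G[OF xy] unfolding geodesic_segment_def by blast
    then have "|G x y| \<le>o |{0..d x y}|" by (simp add: card_of_image)
    then show ?thesis using ordLeq_transitive card_of_mono1[OF subset_UNIV] by blast
  qed
  define C where "C k = ((\<lambda>B. B \<union> (\<Union>x\<in>B. \<Union>y\<in>B. G x y)) ^^ k) A" for k
  have C0: "C 0 = A" and C_Suc: "C (Suc k) = C k \<union> (\<Union>x\<in>C k. \<Union>y\<in>C k. G x y)" for k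
    by (simp_all add: C_def)
  have C: "C k \<subseteq> M \<and> |C k| \<le>o ?c" for k
  proof (induction k)
    case 0
    then show ?case using assms C0 by simp
  next
    case (Suc k)
    then have "|\<Union>x\<in>C k. \<Union>y\<in>C k. G x y| \<le>o ?c"
      using card_G by (intro card_of_UNION_ordLeq_infinite[OF inf] ballI) auto
    then have "|C (Suc k)| \<le>o ?c"
      unfolding C_Suc using Suc inf
      by (intro card_of_Un_ordLeq_infinite_Field[OF _ _ _ card_of_Card_order])
        (simp_all add: Field_card_of)
    moreover have "C (Suc k) \<subseteq> M"
      unfolding C_Suc using Suc geodesic_segment_subset[OF G] by blast
    ultimately show ?case by simp
  qed
  have mono: "C k \<subseteq> C l" if "k \<le> l" for k l
    using that by (rule lift_Suc_mono_le[of C, rotated]) (auto simp: C_Suc)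
  show thesis
  proof (rule that[of "\<Union>k. C k"])
    show "A \<subseteq> (\<Union>k. C k)" using C0 by blast
    show "(\<Union>k. C k) \<subseteq> M" using C by blast
    have "|UNIV :: nat set| \<le>o ?c" using inf infinite_iff_card_of_nat by blast
    then show "|\<Union>k. C k| \<le>o ?c"
      using C by (intro card_of_UNION_ordLeq_infinite[OF inf]) auto
    fix x y assume "x \<in> (\<Union>k. C k)" "y \<in> (\<Union>k. C k)"
    then obtain k l where "x \<in> C k" "y \<in> C l" by blast
    then have xy: "x \<in> C (max k l)" "y \<in> C (max k l)"
      using mono[of k "max k l"] mono[of l "max k l"] by auto
    then have "G x y \<subseteq> C (Suc (max k l))" unfolding C_Suc by blast
    moreover have "geodesic_segment x y (G x y)" using xy C G by blast
    ultimately show "\<exists>S\<subseteq>\<Union>k. C k. geodesic_segment x y S" by blast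
  qed
qed

text \<open>Later \<open>P\<close> is a set of reals that labels the points of a geodesic closure,
  and \<open>g\<close> decodes the labels.\<close>

lemma Metric_space_pullback:
  assumes "inj_on g P" "g ` P \<subseteq> M"
  shows "Metric_space P (\<lambda>u v. d (g u) (g v))"
proof
  fix x y z assume "x \<in> P" "y \<in> P"
  then have *: "g x \<in> M" "g y \<in> M" using assms by auto
  show "d (g x) (g y) = 0 \<longleftrightarrow> x = y"
    using * \<open>x \<in> P\<close> \<open>y \<in> P\<close> assms(1) by (simp add: inj_on_eq_iff)
  assume "z \<in> P"
  then have "g z \<in> M" using assms by auto
  then show "d (g x) (g z) \<le> d (g x) (g y) + d (g y) (g z)"
    using * triangle by blast
qed (simp_all add: commute)

text \<open>Parametrisations are composed with \<open>g\<close> or with its inverse on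
  \<open>P\<close>. One direction serves hyperbolicity, the other the existence of
  geodesics.\<close>

lemma geodesic_segment_pullback_iff:
  assumes "inj_on g P" "g ` P \<subseteq> M" "u \<in> P" "v \<in> P" "S \<subseteq> P"
  shows "Metric_space.geodesic_segment P (\<lambda>u v. d (g u) (g v)) u v S \<longleftrightarrow>
    geodesic_segment (g u) (g v) (g ` S)"
proof -
  interpret P: Metric_space P "\<lambda>u v. d (g u) (g v)"
    using assms(1,2) by (rule Metric_space_pullback)
  let ?I = "{0..d (g u) (g v)}"
  show ?thesis
  proof
    assume "P.geodesic_segment u v S"
    then obtain \<gamma> where "\<gamma> \<in> ?I \<rightarrow> P" "\<gamma> 0 = u" "\<gamma> (d (g u) (g v)) = v"
      "\<forall>s\<in>?I. \<forall>t\<in>?I. d (g (\<gamma> s)) (g (\<gamma> t)) = \<bar>s - t\<bar>" "S = \<gamma> ` ?I"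
      unfolding P.geodesic_segment_def by blast
    then show "geodesic_segment (g u) (g v) (g ` S)"
      unfolding geodesic_segment_def using assms(2)
      by (intro exI[of _ "g \<circ> \<gamma>"]) (auto simp: image_comp Pi_iff)
  next
    assume "geodesic_segment (g u) (g v) (g ` S)"
    then obtain \<gamma> where \<gamma>: "\<gamma> 0 = g u" "\<gamma> (d (g u) (g v)) = g v"
      "\<forall>s\<in>?I. \<forall>t\<in>?I. d (\<gamma> s) (\<gamma> t) = \<bar>s - t\<bar>" "g ` S = \<gamma> ` ?I"
      unfolding geodesic_segment_def by blast
    let ?g = "inv_into P g"
    have g: "g (?g (\<gamma> t)) = \<gamma> t" "?g (\<gamma> t) \<in> P" if "t \<in> ?I" for t
    proof -
      have "\<gamma> t \<in> g ` P" using \<gamma>(4) that assms(5) by blast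
      then show "g (?g (\<gamma> t)) = \<gamma> t" "?g (\<gamma> t) \<in> P"
        by (simp_all add: f_inv_into_f inv_into_into)
    qed
    have "S = ?g ` g ` S" using assms(1,5) by (simp add: inv_into_image_cancel)
    then have "S = (?g \<circ> \<gamma>) ` ?I" using \<gamma>(4) by (simp add: image_comp)
    then show "P.geodesic_segment u v S"
      unfolding P.geodesic_segment_def using g \<gamma> assms(1,3,4)
      by (intro exI[of _ "?g \<circ> \<gamma>"]) auto
  qed
qed

lemma geodesic_space_pullback:
  assumes "inj_on g P" "g ` P \<subseteq> M"
    and "\<And>x y. x \<in> g ` P \<Longrightarrow> y \<in> g ` P \<Longrightarrow> \<exists>S\<subseteq>g ` P. geodesic_segment x y S"
  shows "Metric_space.geodesic_space P (\<lambda>u v. d (g u) (g v))"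
proof -
  interpret P: Metric_space P "\<lambda>u v. d (g u) (g v)"
    using assms(1,2) by (rule Metric_space_pullback)
  show ?thesis
    unfolding P.geodesic_space_def
  proof (intro ballI)
    fix u v assume uv: "u \<in> P" "v \<in> P"
    then obtain S where S: "S \<subseteq> g ` P" "geodesic_segment (g u) (g v) S"
      using assms(3) by blast
    then obtain T where "T \<subseteq> P" "S = g ` T" by (meson subset_image_iff)
    then show "\<exists>S. P.geodesic_segment u v S"
      using geodesic_segment_pullback_iff[OF assms(1,2) uv] S by blast
  qed
qed

text \<open>Thinness passes to subsets: the nearby point lies on another side, hence already in the
  subset.\<close>

lemma hyperbolic_pullback:
  assumes "inj_on g P" "g ` P \<subseteq> M" "hyperbolic \<delta>"
  shows "Metric_space.hyperbolic P (\<lambda>u v. d (g u) (g v)) \<delta>"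
proof -
  interpret P: Metric_space P "\<lambda>u v. d (g u) (g v)"
    using assms(1,2) by (rule Metric_space_pullback)
  have nbhd: "S \<subseteq> P.nbhd \<delta> (T \<union> U)"
    if "S \<subseteq> P" "T \<subseteq> P" "U \<subseteq> P" "g ` S \<subseteq> nbhd \<delta> (g ` T \<union> g ` U)" for S T U
  proof
    fix x assume "x \<in> S"
    then have "x \<in> P" "g x \<in> nbhd \<delta> (g ` T \<union> g ` U)" using that by auto
    then obtain q where "q \<in> T \<union> U" "d (g q) (g x) \<le> \<delta>" unfolding nbhd_def by auto
    with \<open>x \<in> P\<close> that show "x \<in> P.nbhd \<delta> (T \<union> U)" unfolding P.nbhd_def by auto
  qed
  show ?thesis
    unfolding P.hyperbolic_def
  proof (intro ballI allI impI)
    fix x y z S T U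
    assume xyz: "x \<in> P" "y \<in> P" "z \<in> P"
      and seg: "P.geodesic_segment x y S \<and> P.geodesic_segment y z T \<and> P.geodesic_segment z x U"
    then have sub: "S \<subseteq> P" "T \<subseteq> P" "U \<subseteq> P" using P.geodesic_segment_subset by auto
    then have "geodesic_segment (g x) (g y) (g ` S)" "geodesic_segment (g y) (g z) (g ` T)"
      "geodesic_segment (g z) (g x) (g ` U)"
      using seg xyz geodesic_segment_pullback_iff[OF assms(1,2)] by auto
    moreover have "g x \<in> M" "g y \<in> M" "g z \<in> M" using xyz assms(2) by auto
    ultimately have "g ` S \<subseteq> nbhd \<delta> (g ` T \<union> g ` U) \<and> g ` T \<subseteq> nbhd \<delta> (g ` U \<union> g ` S) \<and>
        g ` U \<subseteq> nbhd \<delta> (g ` S \<union> g ` T)"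
      using assms(3) unfolding hyperbolic_def by blast
    with nbhd sub show "S \<subseteq> P.nbhd \<delta> (T \<union> U) \<and> T \<subseteq> P.nbhd \<delta> (U \<union> S) \<and> U \<subseteq> P.nbhd \<delta> (S \<union> T)"
      by auto
  qed
qed

end

lemma admissible_threshold_transfer:
  assumes real: "admissible_threshold TYPE(real) a b N"
  shows "admissible_threshold TYPE('a) a b N"
  unfolding admissible_threshold_def
proof (intro allI impI, elim conjE bexE)
  fix \<delta> :: real and M :: "'a set" and d n \<phi>
  assume \<delta>: "1 \<le> \<delta>" and "Metric_space M d" and geo: "Metric_space.geodesic_space M d"
    and hyp: "Metric_space.hyperbolic M d \<delta>" and n: "N \<le> n" and \<phi>: "\<phi> \<in> {0..<n} \<rightarrow> M"
    and bounds: "\<forall>x\<in>{0..<n}. \<forall>y\<in>{0..<n}. a * real (cycle_dist n x y) \<le> d (\<phi> x) (\<phi> y) \<and>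
              d (\<phi> x) (\<phi> y) \<le> b * real (cycle_dist n x y)"
  interpret Metric_space M d by fact
  have "|\<phi> ` {0..<n}| \<le>o |UNIV :: real set|"
    using ordLeq_transitive[OF card_of_image ordLeq_transitive[OF card_of_mono1[OF subset_UNIV]]]
      infinite_UNIV_char_0 infinite_iff_card_of_nat by blast
  moreover have "\<phi> ` {0..<n} \<subseteq> M" using \<phi> by auto
  ultimately obtain B where B: "\<phi> ` {0..<n} \<subseteq> B" "B \<subseteq> M" "|B| \<le>o |UNIV :: real set|"
    "\<And>x y. x \<in> B \<Longrightarrow> y \<in> B \<Longrightarrow> \<exists>S\<subseteq>B. geodesic_segment x y S"
    using geodesic_closure_continuum[OF geo] by metis
  obtain h :: "'a \<Rightarrow> real" where h: "inj_on h B" using B(3) card_of_ordLeq by metis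
  define P where "P = h ` B"
  define g where "g = inv_into B h"
  have inj: "inj_on g P" unfolding P_def g_def by (simp add: inj_on_inv_into)
  have gP: "g ` P = B" unfolding P_def g_def using h by (simp add: inv_into_image_cancel)
  then have gPM: "g ` P \<subseteq> M" using B(2) by simp
  have gh: "g (h (\<phi> x)) = \<phi> x" if "x < n" for x
    unfolding g_def using that B(1) h by (intro inv_into_f_f) auto
  have "h \<circ> \<phi> \<in> {0..<n} \<rightarrow> P" using B(1) by (auto simp: P_def)
  moreover have "\<forall>x\<in>{0..<n}. \<forall>y\<in>{0..<n}.
      a * real (cycle_dist n x y) \<le> d (g ((h \<circ> \<phi>) x)) (g ((h \<circ> \<phi>) y)) \<and>
      d (g ((h \<circ> \<phi>) x)) (g ((h \<circ> \<phi>) y)) \<le> b * real (cycle_dist n x y)"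
    using bounds gh by simp
  moreover have "Metric_space P (\<lambda>u v. d (g u) (g v))"
    "Metric_space.geodesic_space P (\<lambda>u v. d (g u) (g v))"
    "Metric_space.hyperbolic P (\<lambda>u v. d (g u) (g v)) \<delta>"
    using Metric_space_pullback[OF inj gPM] geodesic_space_pullback[OF inj gPM]
      hyperbolic_pullback[OF inj gPM hyp] B(4) gP by simp_all
  ultimately show "a < 6 * \<delta> * (ln (real n) / real n)"
    using real[unfolded admissible_threshold_def, rule_format, of \<delta> P "\<lambda>u v. d (g u) (g v)" n] \<delta> n
    by blast
qed

subsection \<open>Existence of a threshold\<close>

text \<open>Extending \<phi> periodically unrolls the cycle, so that both arcs become intervals of
  indices and the end \<open>n\<close> repeats \<open>0\<close>. The upper bound on edges spreads by
  the triangle inequality.\<close>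

lemma hyperbolic_cycle_embedding_bound:
  fixes \<phi> :: "nat \<Rightarrow> 'a"
  assumes "Metric_space M d" "Metric_space.geodesic_space M d" "Metric_space.hyperbolic M d \<delta>"
    and "0 < a" "0 < b" "0 < n" and \<phi>: "\<phi> \<in> {0..<n} \<rightarrow> M"
    and bounds: "\<forall>x\<in>{0..<n}. \<forall>y\<in>{0..<n}. a * real (cycle_dist n x y) \<le> d (\<phi> x) (\<phi> y) \<and>
              d (\<phi> x) (\<phi> y) \<le> b * real (cycle_dist n x y)"
  shows "a\<^sup>2 * (real n - 1) / 4 \<le> (a + b) * (N * \<delta> + b * (n / Suc N + 1))"
proof -
  interpret Metric_space M d by fact
  define \<psi> where "\<psi> i = \<phi> (i mod n)" for i
  have \<psi>M: "\<psi> i \<in> M" for i using \<phi> \<open>0 < n\<close> by (auto simp: \<psi>_def)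
  have succ: "d (\<psi> i) (\<psi> (Suc i)) \<le> b" for i
  proof -
    have "(i mod n, Suc i mod n) \<in> cycle_edges n"
      using \<open>0 < n\<close> by (simp add: cycle_edges_def mod_Suc_eq)
    then have "cycle_dist n (i mod n) (Suc i mod n) \<le> 1" by (rule cycle_dist_adjacent_le)
    then have "b * real (cycle_dist n (i mod n) (Suc i mod n)) \<le> b * 1"
      using \<open>0 < b\<close> by (intro mult_left_mono) auto
    moreover have "d (\<psi> i) (\<psi> (Suc i)) \<le> b * real (cycle_dist n (i mod n) (Suc i mod n))"
      using bounds \<open>0 < n\<close> by (simp add: \<psi>_def)
    ultimately show ?thesis by simp
  qed
  have lip: "d (\<psi> i) (\<psi> j) \<le> b * real (j - i)" if "i \<le> j" for i j
    using that
  proof (induction j rule: dec_induct)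
    case base
    then show ?case using \<psi>M by simp
  next
    case (step j)
    have "d (\<psi> i) (\<psi> (Suc j)) \<le> d (\<psi> i) (\<psi> j) + d (\<psi> j) (\<psi> (Suc j))"
      using \<psi>M triangle by blast
    also have "\<dots> \<le> b * real (j - i) + b"
      using step.IH succ by (intro add_mono) auto
    also have "\<dots> = b * real (Suc j - i)"
      using step.hyps by (simp add: Suc_diff_le algebra_simps)
    finally show ?case .
  qed
  have low: "a * real (min (j - i) (n - (j - i))) \<le> d (\<psi> i) (\<psi> j)" if "i \<le> j" "j \<le> n" for i j
  proof -
    \<comment> \<open>Only the index \<open>n\<close> is wrapped to \<open>0\<close>; for
      \<open>i < n\<close> and \<open>j = n\<close> this swaps the two arc lengths.\<close>
    have "int (min (j - i) (n - (j - i))) \<le> int (cycle_dist n (i mod n) (j mod n))"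
      using cycle_dist_lower[of "i mod n" n "j mod n"] \<open>0 < n\<close> that
      by (cases "i = n"; cases "j = n") (auto simp: min_def abs_if of_nat_diff split: if_splits)
    then have "a * real (min (j - i) (n - (j - i))) \<le> a * real (cycle_dist n (i mod n) (j mod n))"
      using \<open>0 < a\<close> by (intro mult_left_mono) auto
    also have "\<dots> \<le> d (\<psi> i) (\<psi> j)"
      using bounds \<open>0 < n\<close> by (simp add: \<psi>_def)
    finally show ?thesis .
  qed
  have "\<psi> n = \<psi> 0" by (simp add: \<psi>_def)
  from hyperbolic_cycle_bound[OF assms(2,3) \<psi>M lip low this assms(4,5)] show ?thesis .
qed

text \<open>In units of \<open>a\<^sup>2 / 16 * n\<close> the left side of the cycle bound is four,
  up to \<open>a\<^sup>2 / 4\<close>. The \<delta> term, the subdivision term and the constants take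
  at most one unit each, a contradiction.\<close>

lemma ex_admissible_threshold:
  assumes "a \<ge> 0" "b \<ge> 1"
  shows "\<exists>N\<ge>2. admissible_threshold TYPE('a) a b N"
proof (cases "a = 0")
  case True
  \<comment> \<open>For \<open>a = 0\<close> the claim is positivity of the right side, clear from
    \<open>\<delta> \<ge> 1\<close> and \<open>n \<ge> 2\<close>.\<close>
  then show ?thesis
    by (intro exI[of _ 2]) (auto simp: admissible_threshold_def)
next
  case False
  with assms have a: "0 < a" and b: "0 < b" by auto
  \<comment> \<open>\<open>K\<close> controls the subdivision term and is fixed before
    \<open>n\<close>, so that the \<delta> term, of order \<open>n / ln n\<close> under the negated
    claim, becomes negligible.\<close>
  obtain K :: nat where K: "16 * (a + b) * b / a\<^sup>2 < K" using reals_Archimedean2 by blast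
  have "\<forall>\<^sub>F n :: nat in sequentially. (a + b) * K * (a / (6 * ln n)) < a\<^sup>2 / 16"
  proof -
    have "((\<lambda>n :: nat. (a + b) * K * (a / (6 * ln n))) \<longlongrightarrow> (a + b) * K * 0) sequentially"
      by (intro tendsto_mult tendsto_const tendsto_divide_0[OF tendsto_const]
          filterlim_at_top_imp_at_infinity filterlim_tendsto_pos_mult_at_top[OF tendsto_const]
          filterlim_compose[OF ln_at_top filterlim_real_sequentially]) auto
    then show ?thesis using a by (intro order_tendstoD) auto
  qed
  then obtain N1 where N1: "\<And>n. N1 \<le> n \<Longrightarrow> (a + b) * K * (a / (6 * ln (real n))) < a\<^sup>2 / 16"
    by (auto simp: eventually_sequentially)
  \<comment> \<open>\<open>N2\<close> absorbs the additive constants, including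
    \<open>a\<^sup>2 / 4\<close> from \<open>n - 1\<close> in place of \<open>n\<close>.\<close>
  obtain N2 :: nat where N2: "((a + b) * b + a\<^sup>2 / 4) / (a\<^sup>2 / 16) < N2"
    using reals_Archimedean2 by blast
  have "admissible_threshold TYPE('a) a b (max 2 (max N1 N2))"
    unfolding admissible_threshold_def
  proof (intro allI impI, elim conjE bexE, rule ccontr)
    fix \<delta> :: real and M :: "'a set" and d n \<phi>
    assume hyp: "Metric_space M d" "Metric_space.geodesic_space M d" "Metric_space.hyperbolic M d \<delta>"
      and n: "max 2 (max N1 N2) \<le> n" and \<phi>: "\<phi> \<in> {0..<n} \<rightarrow> M"
        "\<forall>x\<in>{0..<n}. \<forall>y\<in>{0..<n}. a * real (cycle_dist n x y) \<le> d (\<phi> x) (\<phi> y) \<and>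
              d (\<phi> x) (\<phi> y) \<le> b * real (cycle_dist n x y)"
      and "\<not> a < 6 * \<delta> * (ln (real n) / real n)"
    have n': "0 < n" "0 < real n" "0 < ln (real n)" using n by auto
    have \<delta>: "\<delta> \<le> n * (a / (6 * ln n))"
      using \<open>\<not> a < _\<close> n' by (simp add: field_simps)
    have "(a + b) * K * \<delta> \<le> (a + b) * K * (n * (a / (6 * ln n)))"
      using \<delta> a b by (intro mult_left_mono) auto
    also have "\<dots> = n * ((a + b) * K * (a / (6 * ln n)))" by simp
    also have "\<dots> \<le> n * (a\<^sup>2 / 16)"
      using N1[of n] n n' by (intro mult_left_mono) auto
    also have "\<dots> = a\<^sup>2 / 16 * n" by simp
    finally have 1: "(a + b) * K * \<delta> \<le> a\<^sup>2 / 16 * n" .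
    have "16 * ((a + b) * b) \<le> a\<^sup>2 * K" using K a by (simp add: field_simps)
    also have "\<dots> \<le> a\<^sup>2 * Suc K" using a by (intro mult_left_mono) auto
    finally have "(a + b) * b / Suc K \<le> a\<^sup>2 / 16" by (simp add: field_simps del: of_nat_Suc)
    then have 2: "(a + b) * b / Suc K * n \<le> a\<^sup>2 / 16 * n"
      by (intro mult_right_mono) auto
    have "(a + b) * b + a\<^sup>2 / 4 < a\<^sup>2 / 16 * N2" using N2 a by (simp add: field_simps)
    also have "\<dots> \<le> a\<^sup>2 / 16 * n" using n by (intro mult_left_mono) auto
    finally have 3: "(a + b) * b + a\<^sup>2 / 4 < a\<^sup>2 / 16 * n" .
    have "0 < a\<^sup>2 / 16 * n" using a n' by simp
    have "a\<^sup>2 * (real n - 1) / 4 \<le> (a + b) * (K * \<delta> + b * (n / Suc K + 1))"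
      using hyperbolic_cycle_embedding_bound[OF hyp a b n'(1) \<phi>] .
    also have "\<dots> = (a + b) * K * \<delta> + (a + b) * b / Suc K * n + (a + b) * b"
      by (simp add: algebra_simps add_divide_distrib)
    finally have "a\<^sup>2 * (real n - 1) / 4 \<le> a\<^sup>2 / 16 * n + a\<^sup>2 / 16 * n + (a + b) * b"
      using 1 2 by linarith
    moreover have "a\<^sup>2 * (real n - 1) / 4 = 4 * (a\<^sup>2 / 16 * n) - a\<^sup>2 / 4" by (simp add: field_simps)
    ultimately show False using 3 \<open>0 < a\<^sup>2 / 16 * n\<close> by linarith
  qed
  then show ?thesis by (meson max.cobounded1)
qed

theorem theorem7:
  fixes a b :: real
  assumes "a \<ge> 0" and "b \<ge> 1"
  shows "n\<^sub>0 a b \<ge> 2 \<and>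
    (\<forall>\<delta>\<ge>1. \<forall>(M :: 'a set) d.
       Metric_space M d \<and> Metric_space.geodesic_space M d \<and> Metric_space.hyperbolic M d \<delta> \<longrightarrow>
       (\<forall>n\<ge>n\<^sub>0 a b.
          (\<exists>\<phi> \<in> {0..<n} \<rightarrow> M. \<forall>x\<in>{0..<n}. \<forall>y\<in>{0..<n}.
             a * real (cycle_dist n x y) \<le> d (\<phi> x) (\<phi> y) \<and>
             d (\<phi> x) (\<phi> y) \<le> b * real (cycle_dist n x y)) \<longrightarrow>
          a < 6 * \<delta> * (ln (real n) / real n)))"
proof -
  have "n\<^sub>0 a b \<ge> 2 \<and> admissible_threshold TYPE(real) a b (n\<^sub>0 a b)"
    unfolding n\<^sub>0_def by (rule LeastI_ex) (rule ex_admissible_threshold[OF assms])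
  \<comment> \<open>The minimum was taken over spaces of reals, so its validity for
    \<open>'a\<close> comes from the transfer.\<close>
  then have "n\<^sub>0 a b \<ge> 2 \<and> admissible_threshold TYPE('a) a b (n\<^sub>0 a b)"
    using admissible_threshold_transfer by blast
  then show ?thesis unfolding admissible_threshold_def .
qed

end
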